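(* Let $(M,\omega)$ be the symplectic manifold constructed in the context and $F=(J,H):M\to\mathbb{R}^2$ with $J([z])=\frac12|z_1|^2$, $H([z])=\frac12|z_3|^2$. Then $F$ has precisely the following eight fixed points: $P^{min}:=[0,0,\sqrt2,\sqrt6,\sqrt6,2\sqrt2,2,\sqrt2]$, the fixed point with $z_1=z_2=0$; $B:=[\sqrt2,0,0,\sqrt2,2,2\sqrt2,\sqrt6,\sqrt6]$, the fixed point with $z_2=z_3=0$; $D:=[2,\sqrt2,0,0,\sqrt2,\sqrt6,\sqrt6,2\sqrt2]$, the fixed point with $z_3=z_4=0$; $Q^{min}:=[\sqrt6,\sqrt6,\sqrt2,0,0,\sqrt2,2,2\sqrt2]$, the fixed point with $z_4=z_5=0$; $Q^{max}:=[\sqrt6,2\sqrt2,2,\sqrt2,0,0,\sqrt2,\sqrt6]$, the fixed point with $z_5=z_6=0$; $C:=[2,2\sqrt2,\sqrt6,\sqrt6,\sqrt2,0,0,\sqrt2]$, the fixed point with $z_6=z_7=0$; $A:=[\sqrt2,\sqrt6,\sqrt6,2\sqrt2,2,\sqrt2,0,0]$, the fixed point with $z_7=z_8=0$; $P^{max}:=[0,\sqrt2,2,2\sqrt2,\sqrt6,\sqrt6,\sqrt2,0]$, the fixed point with $z_8=z_1=0$. They are mapped under $F$ to the vertices of the octagon with vertices $(0,1),(1,0),(2,0),(3,1),(3,2),(2,3),(1,3),(0,2)$, namely (in the order $P^{min},B,D,Q^{min},Q^{max},C,A,P^{max}$ of points) $P^{min}\mapsto(0,1)$, $B\mapsto(1,0)$,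 $D\mapsto(2,0)$, $Q^{min}\mapsto(3,1)$, $Q^{max}\mapsto(3,2)$, $C\mapsto(2,3)$, $A\mapsto(1,3)$, $P^{max}\mapsto(0,2)$.
   Context: Construction of $(M,\omega)$. On $\mathbb{C}^8$ with coordinates $z_k=x_k+iy_k$ take the symplectic form $\omega_{st}=-\frac{i}{2}\sum_{k=1}^8 dz_k\wedge d\bar z_k$. Let $W\subset\mathbb{C}^8$ be the set of points satisfying (A) $|z_1|^2+|z_5|^2=6$, (B) $|z_2|^2+|z_5|^2+|z_7|^2=10$, (C) $|z_3|^2+|z_7|^2=6$, (D) $|z_4|^2-|z_5|^2+|z_7|^2=4$, (E) $|z_5|^2-|z_6|^2+|z_7|^2=2$, (F) $|z_5|^2-|z_7|^2+|z_8|^2=4$. The torus $N\simeq\mathbb{T}^6=(\mathbb{R}/2\pi\mathbb{Z})^6$ acts on $\mathbb{C}^8$ by $$(t,z)\mapsto(e^{it_1}z_1,e^{it_2}z_2,e^{it_3}z_3,e^{it_4}z_4,e^{i(t_1+t_2-t_4-t_5+t_6)}z_5,e^{it_5}z_6,e^{i(t_2+t_3+t_4-t_5-t_6)}z_7,e^{it_6}z_8).$$ $W$ is a regular level set of a momentum map of this action, $N$ acts freely on $W$, and $M:=W/N$ with quotient map $\tau:W\to M$ is a $4$-dimensional compact connected manifold carrying the unique symplectic form $\omega$ with $\tau^*\omega=\kappa^*\omega_{st}$, where $\kappa:W\hookrightarrow\mathbb{C}^8$ is the inclusion. Points of $M$ are written $[z]=[z_1,\dots,z_8]$. A fixed point of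 $F$ is a point $p\in M$ with $dF(p)=0$. *)

theory Defs
  imports "HOL-Analysis.Analysis"
begin

section \<open>The level set, the torus action and the quotient\<close>

text \<open>
  The coordinates are the components \<open>z $ 1, \<dots>, z $ 8\<close>; in the index type \<open>8\<close> the numeral \<open>8\<close>
  denotes the same element as \<open>0\<close>, so these are eight distinct components.
\<close>

definition level_set :: "(complex ^ 8) set" where
  "level_set = {z.
     (cmod (z $ 1))\<^sup>2 + (cmod (z $ 5))\<^sup>2 = 6 \<and>
     (cmod (z $ 2))\<^sup>2 + (cmod (z $ 5))\<^sup>2 + (cmod (z $ 7))\<^sup>2 = 10 \<and>
     (cmod (z $ 3))\<^sup>2 + (cmod (z $ 7))\<^sup>2 = 6 \<and>
     (cmod (z $ 4))\<^sup>2 - (cmod (z $ 5))\<^sup>2 + (cmod (z $ 7))\<^sup>2 = 4 \<and>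
     (cmod (z $ 5))\<^sup>2 - (cmod (z $ 6))\<^sup>2 + (cmod (z $ 7))\<^sup>2 = 2 \<and>
     (cmod (z $ 5))\<^sup>2 - (cmod (z $ 7))\<^sup>2 + (cmod (z $ 8))\<^sup>2 = 4}"

text \<open>
  The action of the torus \<open>(\<real> / 2 \<pi> \<int>)\<^sup>6\<close>, written on angle vectors in \<open>\<real>\<^sup>6\<close>: it is
  \<open>2 \<pi>\<close>-periodic in every angle, so the orbits are those of the torus.  Here \<open>cis t\<close> is
  \<open>exp (\<i> t)\<close>.
\<close>

definition torus_act :: "real ^ 6 \<Rightarrow> complex ^ 8 \<Rightarrow> complex ^ 8" where
  "torus_act t z = vector
     [cis (t $ 1) * z $ 1,
      cis (t $ 2) * z $ 2,
      cis (t $ 3) * z $ 3,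
      cis (t $ 4) * z $ 4,
      cis (t $ 1 + t $ 2 - t $ 4 - t $ 5 + t $ 6) * z $ 5,
      cis (t $ 5) * z $ 6,
      cis (t $ 2 + t $ 3 + t $ 4 - t $ 5 - t $ 6) * z $ 7,
      cis (t $ 6) * z $ 8]"

type_synonym point = "(complex ^ 8) set"

definition orbit :: "complex ^ 8 \<Rightarrow> point" where
  "orbit z = range (\<lambda>t. torus_act t z)"

definition quotient_manifold :: "point set" where
  "quotient_manifold = orbit ` level_set"

text \<open>The class \<open>[x\<^sub>1, \<dots>, x\<^sub>8]\<close> of a point with real coordinates.\<close>

definition point_of :: "real list \<Rightarrow> point" where
  "point_of xs = orbit (vector (map complex_of_real xs))"

section \<open>The smooth structure of the quotient and differentials\<close>

text \<open>\<open>Ck_on k f S\<close>: the function \<open>f\<close> is \<open>k\<close> times continuously differentiable on the open set \<open>S\<close>.\<close>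

primrec Ck_on :: "nat \<Rightarrow> ('a::euclidean_space \<Rightarrow> real) \<Rightarrow> 'a set \<Rightarrow> bool" where
  "Ck_on 0 f S \<longleftrightarrow> continuous_on S f"
| "Ck_on (Suc k) f S \<longleftrightarrow>
     (\<forall>x\<in>S. f differentiable (at x)) \<and>
     (\<forall>v. Ck_on k (\<lambda>x. frechet_derivative f (at x) v) S)"

definition smooth_on_open :: "('a::euclidean_space \<Rightarrow> real) \<Rightarrow> 'a set \<Rightarrow> bool" where
  "smooth_on_open f S \<longleftrightarrow> open S \<and> (\<forall>k. Ck_on k f S)"

text \<open>
  A function on an embedded submanifold is smooth iff near each point of the submanifold it is the
  restriction of a smooth function on an open set of the ambient space.
\<close>

definition smooth_on_subset :: "('a::euclidean_space \<Rightarrow> real) \<Rightarrow> 'a set \<Rightarrow> bool" where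
  "smooth_on_subset f S \<longleftrightarrow>
     (\<forall>w\<in>S. \<exists>U g. w \<in> U \<and> smooth_on_open g U \<and> (\<forall>x\<in>U \<inter> S. g x = f x))"

text \<open>
  The smooth structure of \<open>level_set / torus\<close> is the one for which the quotient map \<open>orbit\<close> is a
  submersion; it is given by its algebra of smooth functions, which are the functions with
  smooth pullback to the level set.  Only the values on \<open>quotient_manifold\<close> matter.
\<close>

definition smooth_functions :: "(point \<Rightarrow> real) set" where
  "smooth_functions = {f. smooth_on_subset (f \<circ> orbit) level_set}"

text \<open>
  Tangent vectors at \<open>p\<close> are the derivations at \<open>p\<close> of the algebra of smooth functions.  The first
  condition says that a derivation acts on functions defined on the manifold, and not on
  their arbitrary extensions to the whole type; outside \<open>smooth_functions\<close> the value of \<open>X\<close> is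
  irrelevant.
\<close>

definition tangent_space :: "point \<Rightarrow> ((point \<Rightarrow> real) \<Rightarrow> real) set" where
  "tangent_space p = {X.
     (\<forall>f\<in>smooth_functions. \<forall>g\<in>smooth_functions.
        (\<forall>q\<in>quotient_manifold. f q = g q) \<longrightarrow> X f = X g) \<and>
     (\<forall>f\<in>smooth_functions. \<forall>g\<in>smooth_functions. \<forall>a b.
        X (\<lambda>q. a * f q + b * g q) = a * X f + b * X g) \<and>
     (\<forall>f\<in>smooth_functions. \<forall>g\<in>smooth_functions.
        X (\<lambda>q. f q * g q) = f p * X g + g p * X f)}"

text \<open>
  The differential of a smooth map to the plane, with the tangent spaces of the plane identified
  with the plane itself.
\<close>

definition differential ::
  "(point \<Rightarrow> real \<times> real) \<Rightarrow> ((point \<Rightarrow> real) \<Rightarrow> real) \<Rightarrow> real \<times> real" where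
  "differential G X = (X (fst \<circ> G), X (snd \<circ> G))"

definition fixed_points :: "(point \<Rightarrow> real \<times> real) \<Rightarrow> point set" where
  "fixed_points G = {p \<in> quotient_manifold. \<forall>X\<in>tangent_space p. differential G X = 0}"

section \<open>The map and the eight points\<close>

text \<open>\<open>the_elem\<close> picks the common value of an invariant function on an orbit.\<close>

definition J_fun :: "point \<Rightarrow> real" where
  "J_fun p = the_elem ((\<lambda>z. (cmod (z $ 1))\<^sup>2 / 2) ` p)"

definition H_fun :: "point \<Rightarrow> real" where
  "H_fun p = the_elem ((\<lambda>z. (cmod (z $ 3))\<^sup>2 / 2) ` p)"

definition F_map :: "point \<Rightarrow> real \<times> real" where
  "F_map p = (J_fun p, H_fun p)"

definition P_min :: point where
  "P_min = point_of [0, 0, sqrt 2, sqrt 6, sqrt 6, 2 * sqrt 2, 2, sqrt 2]"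

definition pt_B :: point where
  "pt_B = point_of [sqrt 2, 0, 0, sqrt 2, 2, 2 * sqrt 2, sqrt 6, sqrt 6]"

definition pt_D :: point where
  "pt_D = point_of [2, sqrt 2, 0, 0, sqrt 2, sqrt 6, sqrt 6, 2 * sqrt 2]"

definition Q_min :: point where
  "Q_min = point_of [sqrt 6, sqrt 6, sqrt 2, 0, 0, sqrt 2, 2, 2 * sqrt 2]"

definition Q_max :: point where
  "Q_max = point_of [sqrt 6, 2 * sqrt 2, 2, sqrt 2, 0, 0, sqrt 2, sqrt 6]"

definition pt_C :: point where
  "pt_C = point_of [2, 2 * sqrt 2, sqrt 6, sqrt 6, sqrt 2, 0, 0, sqrt 2]"

definition pt_A :: point where
  "pt_A = point_of [sqrt 2, sqrt 6, sqrt 6, 2 * sqrt 2, 2, sqrt 2, 0, 0]"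

definition P_max :: point where
  "P_max = point_of [0, sqrt 2, 2, 2 * sqrt 2, sqrt 6, sqrt 6, sqrt 2, 0]"

text \<open>The points of a set at which the coordinates \<open>z\<^sub>i\<close> and \<open>z\<^sub>j\<close> vanish (on the whole orbit).\<close>

definition with_zeros :: "8 \<Rightarrow> 8 \<Rightarrow> point set \<Rightarrow> point set" where
  "with_zeros i j S = {p \<in> S. \<forall>z\<in>p. z $ i = 0 \<and> z $ j = 0}"

definition octagon :: "(real \<times> real) set" where
  "octagon = convex hull {(0, 1), (1, 0), (2, 0), (3, 1), (3, 2), (2, 3), (1, 3), (0, 2)}"

end

theory Submission
  imports Defs
begin

text \<open>
  In the coordinates \<open>a = \<bar>z\<^sub>1\<bar>\<^sup>2\<close> and \<open>c = \<bar>z\<^sub>3\<bar>\<^sup>2\<close> the level set is described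
  by \<open>\<bar>z\<^sub>k\<bar>\<^sup>2 = \<lambda>\<^sub>k + n\<^sub>k \<cdot> (a, c)\<close>, where \<open>n\<^sub>1, \<dots>, n\<^sub>8\<close> are the primitive inward normals of an
  octagon.  So the quotient is the toric surface of a Delzant octagon, \<open>z\<^sub>k\<close> vanishes
  over the \<open>k\<close>-th edge, and \<open>F = (a, c) / 2\<close> is the toric momentum map.  Its fixed points are the
  points over the vertices.  Consecutive indices label adjacent edges, and
  two coordinates can vanish together only on adjacent edges (\<open>zero_pairs_adjacent\<close>).

  Over a vertex, where the edges \<open>i\<close> and \<open>j\<close> meet, there is exactly one point: the
  vanishing of \<open>z\<^sub>i\<close> and \<open>z\<^sub>j\<close> determines all moduli, and the phases of the other six coordinates can
  be matched by the torus (\<open>norms_eq_if_two_zeros\<close>, \<open>orbit_eq_if_two_zeros\<close>).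

  This point is critical (\<open>vertex_fixed\<close>).  As \<open>n\<^sub>i, n\<^sub>j\<close> is a lattice basis, some vector \<open>(p, q)\<close> pairs
  to \<open>\<plusminus>1\<close> with \<open>n\<^sub>i\<close> and to \<open>0\<close> with \<open>n\<^sub>j\<close>.  The torus-invariant monomial \<open>u\<close> with exponents
  \<open>n\<^sub>k \<cdot> (p, q)\<close>, negative exponents being read as powers of the conjugate, satisfies
  \<open>(Re u)\<^sup>2 + (Im u)\<^sup>2 = \<bar>z\<^sub>i\<bar>\<^sup>2 Q\<close> with \<open>Q \<noteq> 0\<close> at the point.  A derivation kills the left-hand side because
  \<open>u\<close> vanishes there; hence it kills \<open>\<bar>z\<^sub>i\<bar>\<^sup>2\<close>, likewise \<open>\<bar>z\<^sub>j\<bar>\<^sup>2\<close>, and so both components of \<open>F\<close>.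

  At any other point at most one coordinate vanishes, so some \<open>(p, q) \<noteq> 0\<close> is
  orthogonal to the normals of all vanishing coordinates.  Rescaling the coordinates of
  a representative gives a curve in the level set along which \<open>(a, c)\<close> moves with velocity \<open>(p, q)\<close>.
  Differentiation along it is a tangent vector on which \<open>dF\<close> is not zero
  (\<open>curve_derivation\<close>, \<open>not_fixed_if_direction\<close>).
\<close>

section \<open>Eight coordinates\<close>

lemma exhaust_8:
  fixes k :: 8
  shows "k = 1 \<or> k = 2 \<or> k = 3 \<or> k = 4 \<or> k = 5 \<or> k = 6 \<or> k = 7 \<or> k = 8"
proof (induct k)
  case (of_int z)
  then have "z = 0 \<or> z = 1 \<or> z = 2 \<or> z = 3 \<or> z = 4 \<or> z = 5 \<or> z = 6 \<or> z = 7" by fastforce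
  then show ?case by auto
qed

lemma forall_8:
  "(\<forall>k::8. P k) \<longleftrightarrow> P 1 \<and> P 2 \<and> P 3 \<and> P 4 \<and> P 5 \<and> P 6 \<and> P 7 \<and> P 8"
  by (metis exhaust_8)

lemma UNIV_8: "UNIV = {1, 2, 3, 4, 5, 6, 7, 8::8}"
  using exhaust_8 by auto

lemma sum_8: "sum f (UNIV::8 set) = f 1 + f 2 + f 3 + f 4 + f 5 + f 6 + f 7 + f 8"
  unfolding UNIV_8 by (simp add: ac_simps)

lemma vector_8 [simp]:
  fixes a b c d e f g h :: "'a::zero"
  defines "v \<equiv> vector [a, b, c, d, e, f, g, h] :: 'a ^ 8"
  shows "v $ 1 = a" "v $ 2 = b" "v $ 3 = c" "v $ 4 = d"
    "v $ 5 = e" "v $ 6 = f" "v $ 7 = g" "v $ 8 = h"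
  unfolding v_def vector_def by simp_all

lemma vector_6 [simp]:
  fixes a b c d e f :: "'a::zero"
  defines "v \<equiv> vector [a, b, c, d, e, f] :: 'a ^ 6"
  shows "v $ 1 = a" "v $ 2 = b" "v $ 3 = c" "v $ 4 = d" "v $ 5 = e" "v $ 6 = f"
  unfolding v_def vector_def by simp_all

section \<open>The edges of the octagon\<close>

text \<open>
  The vectors \<open>(normal_x $ k, normal_y $ k)\<close> are the inward normals of the octagon that the
  points \<open>(\<bar>z\<^sub>1\<bar>\<^sup>2, \<bar>z\<^sub>3\<bar>\<^sup>2)\<close> sweep out.  They are integral because they also serve as the
  exponents of invariant monomials.
\<close>

definition normal_x :: "int ^ 8" where
  "normal_x = vector [1, 1, 0, - 1, - 1, - 1, 0, 1]"

definition normal_y :: "int ^ 8" where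
  "normal_y = vector [0, 1, 1, 1, 0, - 1, - 1, - 1]"

definition offset :: "real ^ 8" where
  "offset = vector [0, - 2, 0, 4, 6, 10, 6, 4]"

definition facet_det :: "8 \<Rightarrow> 8 \<Rightarrow> int" where
  "facet_det i j = normal_x $ i * normal_y $ j - normal_y $ i * normal_x $ j"

definition pairing :: "int \<Rightarrow> int \<Rightarrow> 8 \<Rightarrow> int" where
  "pairing p q k = p * normal_x $ k + q * normal_y $ k"

text \<open>
  Solving the six equations for the moduli in terms of \<open>\<bar>z\<^sub>1\<bar>\<^sup>2\<close> and \<open>\<bar>z\<^sub>3\<bar>\<^sup>2\<close> treats all
  coordinates alike.  The equation is circular for \<open>k = 1\<close> and \<open>k = 3\<close>, so it must not be
  used as a rewrite rule.
\<close>

lemma level_set_iff: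
  "z \<in> level_set \<longleftrightarrow>
     (\<forall>k. (cmod (z $ k))\<^sup>2 =
        offset $ k + of_int (normal_x $ k) * (cmod (z $ 1))\<^sup>2 + of_int (normal_y $ k) * (cmod (z $ 3))\<^sup>2)"
  unfolding level_set_def forall_8 normal_x_def normal_y_def offset_def vector_8 mem_Collect_eq
    of_int_minus of_int_1 of_int_0
  by (intro iffI; elim conjE; intro conjI; linarith)

lemma level_setD:
  assumes "z \<in> level_set"
  shows "(cmod (z $ k))\<^sup>2 =
        offset $ k + of_int (normal_x $ k) * (cmod (z $ 1))\<^sup>2 + of_int (normal_y $ k) * (cmod (z $ 3))\<^sup>2"
  using assms level_set_iff by blast

text \<open>
  Cramer's rule.  It is applied both to differences of moduli and to the values of a derivation.
\<close>

lemma independent_normals_solve: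
  fixes a b :: real
  assumes det: "facet_det i j \<noteq> 0"
    and i: "of_int (normal_x $ i) * a + of_int (normal_y $ i) * b = 0"
    and j: "of_int (normal_x $ j) * a + of_int (normal_y $ j) * b = 0"
  shows "a = 0 \<and> b = 0"
proof -
  have "of_int (facet_det i j) * a =
      of_int (normal_y $ j) * (of_int (normal_x $ i) * a + of_int (normal_y $ i) * b) -
      of_int (normal_y $ i) * (of_int (normal_x $ j) * a + of_int (normal_y $ j) * b)"
    "of_int (facet_det i j) * b =
      of_int (normal_x $ i) * (of_int (normal_x $ j) * a + of_int (normal_y $ j) * b) -
      of_int (normal_x $ j) * (of_int (normal_x $ i) * a + of_int (normal_y $ i) * b)"
    by (simp_all add: facet_det_def algebra_simps)
  then have "of_int (facet_det i j) * a = 0" "of_int (facet_det i j) * b = 0"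
    by (simp_all only: i j mult_zero_right diff_zero)
  then show ?thesis using det by (simp only: mult_eq_0_iff of_int_eq_0_iff simp_thms)
qed

lemma norms_eq_if_two_zeros:
  assumes w: "w \<in> level_set" "w $ i = 0" "w $ j = 0" and z: "z \<in> level_set" "z $ i = 0" "z $ j = 0"
    and det: "facet_det i j \<noteq> 0"
  shows "cmod (w $ k) = cmod (z $ k)"
proof -
  define a b where "a = (cmod (w $ 1))\<^sup>2 - (cmod (z $ 1))\<^sup>2" and "b = (cmod (w $ 3))\<^sup>2 - (cmod (z $ 3))\<^sup>2"
  have diff: "(cmod (w $ k))\<^sup>2 - (cmod (z $ k))\<^sup>2 = of_int (normal_x $ k) * a + of_int (normal_y $ k) * b" for k
    using level_setD[OF w(1), of k] level_setD[OF z(1), of k]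
    unfolding a_def b_def right_diff_distrib by linarith
  have "a = 0 \<and> b = 0"
    by (rule independent_normals_solve[OF det]) (use diff[of i] diff[of j] w z in simp_all)
  then have "(cmod (w $ k))\<^sup>2 = (cmod (z $ k))\<^sup>2" using diff[of k] by simp
  then show ?thesis by (rule power2_eq_imp_eq) simp_all
qed

text \<open>
  Two non-adjacent edges of the octagon do not meet: the inequalities \<open>\<bar>z\<^sub>k\<bar>\<^sup>2 \<ge> 0\<close> exclude
  each of the twenty pairs.
\<close>

lemma zero_pairs_adjacent:
  assumes "z \<in> level_set" "z $ i = 0" "z $ j = 0" "i \<noteq> j"
  shows "z $ 1 = 0 \<and> z $ 2 = 0 \<or> z $ 2 = 0 \<and> z $ 3 = 0 \<or> z $ 3 = 0 \<and> z $ 4 = 0 \<or>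
    z $ 4 = 0 \<and> z $ 5 = 0 \<or> z $ 5 = 0 \<and> z $ 6 = 0 \<or> z $ 6 = 0 \<and> z $ 7 = 0 \<or>
    z $ 7 = 0 \<and> z $ 8 = 0 \<or> z $ 8 = 0 \<and> z $ 1 = 0"
proof -
  define N where "N k = (cmod (z $ k))\<^sup>2" for k
  define Z where "Z k \<longleftrightarrow> z $ k = 0" for k
  have Z: "Z k \<longleftrightarrow> N k = 0" for k by (simp add: N_def Z_def)
  have pos: "N k \<ge> 0" for k by (simp add: N_def)
  have eqs: "N 1 + N 5 = 6" "N 2 + N 5 + N 7 = 10" "N 3 + N 7 = 6" "N 4 - N 5 + N 7 = 4"
    "N 5 - N 6 + N 7 = 2" "N 5 - N 7 + N 8 = 4"
    using assms(1) by (auto simp: level_set_def N_def)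
  note bounds = eqs pos[of 1] pos[of 2] pos[of 3] pos[of 4] pos[of 5] pos[of 6] pos[of 7] pos[of 8]
  have apart: "Z 1 \<Longrightarrow> Z 3 \<Longrightarrow> False" "Z 1 \<Longrightarrow> Z 4 \<Longrightarrow> False" "Z 1 \<Longrightarrow> Z 5 \<Longrightarrow> False" "Z 1 \<Longrightarrow> Z 6 \<Longrightarrow> False"
    "Z 1 \<Longrightarrow> Z 7 \<Longrightarrow> False" "Z 2 \<Longrightarrow> Z 4 \<Longrightarrow> False" "Z 2 \<Longrightarrow> Z 5 \<Longrightarrow> False" "Z 2 \<Longrightarrow> Z 6 \<Longrightarrow> False"
    "Z 2 \<Longrightarrow> Z 7 \<Longrightarrow> False" "Z 2 \<Longrightarrow> Z 8 \<Longrightarrow> False" "Z 3 \<Longrightarrow> Z 5 \<Longrightarrow> False" "Z 3 \<Longrightarrow> Z 6 \<Longrightarrow> False"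
    "Z 3 \<Longrightarrow> Z 7 \<Longrightarrow> False" "Z 3 \<Longrightarrow> Z 8 \<Longrightarrow> False" "Z 4 \<Longrightarrow> Z 6 \<Longrightarrow> False" "Z 4 \<Longrightarrow> Z 7 \<Longrightarrow> False"
    "Z 4 \<Longrightarrow> Z 8 \<Longrightarrow> False" "Z 5 \<Longrightarrow> Z 7 \<Longrightarrow> False" "Z 5 \<Longrightarrow> Z 8 \<Longrightarrow> False" "Z 6 \<Longrightarrow> Z 8 \<Longrightarrow> False"
    unfolding Z using bounds by linarith+
  show ?thesis
    unfolding Z_def[symmetric]
  proof (rule ccontr)
    assume "\<not> (Z 1 \<and> Z 2 \<or> Z 2 \<and> Z 3 \<or> Z 3 \<and> Z 4 \<or> Z 4 \<and> Z 5 \<or> Z 5 \<and> Z 6 \<or> Z 6 \<and> Z 7 \<or> Z 7 \<and> Z 8 \<or> Z 8 \<and> Z 1)"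
    then have adjacent: "Z 1 \<Longrightarrow> Z 2 \<Longrightarrow> False" "Z 2 \<Longrightarrow> Z 3 \<Longrightarrow> False" "Z 3 \<Longrightarrow> Z 4 \<Longrightarrow> False"
      "Z 4 \<Longrightarrow> Z 5 \<Longrightarrow> False" "Z 5 \<Longrightarrow> Z 6 \<Longrightarrow> False" "Z 6 \<Longrightarrow> Z 7 \<Longrightarrow> False" "Z 7 \<Longrightarrow> Z 8 \<Longrightarrow> False"
      "Z 1 \<Longrightarrow> Z 8 \<Longrightarrow> False"
      by simp_all
    have "\<forall>k l. Z k \<longrightarrow> Z l \<longrightarrow> k = l"
      unfolding forall_8
      by (intro conjI impI; (rule refl | erule (1) apart[THEN FalseE] adjacent[THEN FalseE]))
    then show False using assms by (auto simp: Z_def)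
  qed
qed

section \<open>Orbits\<close>

text \<open>The angle by which the torus element \<open>t\<close> turns the coordinate \<open>z\<^sub>k\<close>.\<close>

definition weight :: "real ^ 6 \<Rightarrow> 8 \<Rightarrow> real" where
  "weight t k = vector
     [t $ 1, t $ 2, t $ 3, t $ 4, t $ 1 + t $ 2 - t $ 4 - t $ 5 + t $ 6, t $ 5,
      t $ 2 + t $ 3 + t $ 4 - t $ 5 - t $ 6, t $ 6] $ k"

lemma torus_act_nth: "torus_act t z $ k = cis (weight t k) * z $ k"
proof -
  have "\<forall>k. torus_act t z $ k = cis (weight t k) * z $ k"
    unfolding forall_8 torus_act_def weight_def by simp
  then show ?thesis ..
qed

lemma weight_add: "weight (s + t) k = weight s k + weight t k"
proof -
  have "\<forall>k. weight (s + t) k = weight s k + weight t k"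
    unfolding forall_8 weight_def by simp
  then show ?thesis ..
qed

text \<open>
  Together with \<open>weight_surj\<close> this says that the rotations in the torus are exactly those in the
  kernel of the two functionals given by the normals.  Hence no further computation
  with the six angles is necessary.
\<close>

lemma weight_balanced:
  "(\<Sum>k\<in>UNIV. of_int (normal_x $ k) * weight t k) = 0"
  "(\<Sum>k\<in>UNIV. of_int (normal_y $ k) * weight t k) = 0"
  by (simp_all add: sum_8 normal_x_def normal_y_def weight_def)

lemma weight_surj:
  assumes "(\<Sum>k\<in>UNIV. of_int (normal_x $ k) * \<theta> k) = 0" "(\<Sum>k\<in>UNIV. of_int (normal_y $ k) * \<theta> k) = 0"
  obtains t where "\<And>k. weight t k = \<theta> k"
proof
  fix k
  have "\<forall>k. weight (vector [\<theta> 1, \<theta> 2, \<theta> 3, \<theta> 4, \<theta> 6, \<theta> 8]) k = \<theta> k"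
    using assms unfolding forall_8 by (simp add: sum_8 normal_x_def normal_y_def weight_def)
  then show "weight (vector [\<theta> 1, \<theta> 2, \<theta> 3, \<theta> 4, \<theta> 6, \<theta> 8]) k = \<theta> k" ..
qed

lemma torus_act_add: "torus_act s (torus_act t z) = torus_act (s + t) z"
  by (simp add: vec_eq_iff torus_act_nth weight_add cis_mult[symmetric] mult_ac)

lemma orbit_torus_act: "orbit (torus_act t z) = orbit z"
proof -
  have "torus_act s z \<in> range (\<lambda>s. torus_act (s + t) z)" for s
    by (rule range_eqI[of _ _ "s - t"]) simp
  then show ?thesis by (auto simp: orbit_def torus_act_add)
qed

lemma self_in_orbit: "z \<in> orbit z"
proof -
  have "weight 0 k = 0" for k using weight_add[of 0 0 k] by simp
  then have "torus_act 0 z = z" by (simp add: vec_eq_iff torus_act_nth)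
  then show ?thesis unfolding orbit_def by (metis rangeI)
qed

lemma norm_torus_act: "cmod (torus_act t z $ k) = cmod (z $ k)"
  by (simp add: torus_act_nth norm_mult)

lemma zero_in_orbit_iff: "w \<in> orbit z \<Longrightarrow> w $ k = 0 \<longleftrightarrow> z $ k = 0"
  by (auto simp: orbit_def torus_act_nth)

text \<open>
  The phases of \<open>z\<^sub>i\<close> and \<open>z\<^sub>j\<close> are free because these coordinates vanish.  Since \<open>n\<^sub>i\<close> and \<open>n\<^sub>j\<close> are
  independent, these two phases can be chosen such that the rotation from \<open>z\<close> to \<open>w\<close> lies in the torus.
\<close>

lemma orbit_eq_if_two_zeros:
  assumes norms: "\<And>k. cmod (w $ k) = cmod (z $ k)" and zeros: "z $ i = 0" "z $ j = 0"
    and det: "facet_det i j \<noteq> 0"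
  shows "orbit w = orbit z"
proof -
  define \<phi> where "\<phi> k = Arg (w $ k) - Arg (z $ k)" for k
  have \<phi>: "w $ k = cis (\<phi> k) * z $ k" for k
  proof -
    have "cis (\<phi> k) * z $ k = cis (\<phi> k) * rcis (cmod (w $ k)) (Arg (z $ k))"
      by (simp add: norms rcis_cmod_Arg)
    also have "\<dots> = rcis (cmod (w $ k)) (Arg (w $ k))"
      by (simp add: \<phi>_def rcis_def cis_mult)
    finally show ?thesis by (simp add: rcis_cmod_Arg)
  qed
  let ?nx = "\<lambda>k. of_int (normal_x $ k) :: real" and ?ny = "\<lambda>k. of_int (normal_y $ k) :: real"
  define A B D where "A = (\<Sum>k\<in>UNIV. ?nx k * \<phi> k)" and "B = (\<Sum>k\<in>UNIV. ?ny k * \<phi> k)"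
    and "D = (of_int (facet_det i j) :: real)"
  have D: "D = ?nx i * ?ny j - ?ny i * ?nx j" "D \<noteq> 0"
    using det by (simp_all only: D_def of_int_eq_0_iff not_False_eq_True) (simp add: facet_det_def)
  define \<alpha> \<beta> where "\<alpha> = (?nx j * B - ?ny j * A) / D" and "\<beta> = (?ny i * A - ?nx i * B) / D"
  have cramer: "?nx i * \<alpha> + ?nx j * \<beta> = - A" "?ny i * \<alpha> + ?ny j * \<beta> = - B"
  proof -
    have "?nx i * \<alpha> + ?nx j * \<beta> = - (D * A) / D" "?ny i * \<alpha> + ?ny j * \<beta> = - (D * B) / D"
      unfolding \<alpha>_def \<beta>_def times_divide_eq_right add_divide_distrib[symmetric] D(1)
      by (simp_all add: algebra_simps)
    then show "?nx i * \<alpha> + ?nx j * \<beta> = - A" "?ny i * \<alpha> + ?ny j * \<beta> = - B"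
      using D(2) by simp_all
  qed
  \<comment> \<open>The correction in the positions \<open>i\<close> and \<open>j\<close> cancels the imbalance \<open>(A, B)\<close> of \<open>\<phi>\<close>.\<close>
  define \<theta> where "\<theta> k = \<phi> k + ((if k = i then \<alpha> else 0) + (if k = j then \<beta> else 0))" for k
  have sum_\<theta>: "(\<Sum>k\<in>UNIV. c k * \<theta> k) = (\<Sum>k\<in>UNIV. c k * \<phi> k) + (c i * \<alpha> + c j * \<beta>)" for c
    by (simp add: \<theta>_def distrib_left sum.distrib if_distrib[of "\<lambda>x. c _ * x"] cong: if_cong)
  obtain t where t: "\<And>k. weight t k = \<theta> k"
    using weight_surj[of \<theta>] sum_\<theta>[of ?nx] sum_\<theta>[of ?ny] cramer by (auto simp: A_def B_def)
  have "w = torus_act t z"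
    using \<phi> zeros by (auto simp: vec_eq_iff torus_act_nth t \<theta>_def)
  then show ?thesis by (simp add: orbit_torus_act)
qed

section \<open>Polynomials are smooth\<close>

text \<open>
  Directional derivatives of polynomials are polynomials, which makes \<open>Ck_on\<close> accessible to
  induction.
\<close>

lemma real_polynomial_function_has_derivative:
  assumes "real_polynomial_function f"
  shows "\<exists>D. (\<forall>x. (f has_derivative D x) (at x)) \<and> (\<forall>v. real_polynomial_function (\<lambda>x. D x v))"
  using assms
proof induction
  case (linear f)
  then show ?case
    by (intro exI[of _ "\<lambda>x. f"]) (auto intro: bounded_linear_imp_has_derivative)
next
  case (const c)
  then show ?case by (intro exI[of _ "\<lambda>x v. 0"]) auto
next
  case (add f g)
  then obtain D E where "\<forall>x. (f has_derivative D x) (at x)" "\<forall>v. real_polynomial_function (\<lambda>x. D x v)"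
    "\<forall>x. (g has_derivative E x) (at x)" "\<forall>v. real_polynomial_function (\<lambda>x. E x v)" by blast
  then show ?case
    by (intro exI[of _ "\<lambda>x v. D x v + E x v"]) (auto intro: has_derivative_add)
next
  case (mult f g)
  then obtain D E where "\<forall>x. (f has_derivative D x) (at x)" "\<forall>v. real_polynomial_function (\<lambda>x. D x v)"
    "\<forall>x. (g has_derivative E x) (at x)" "\<forall>v. real_polynomial_function (\<lambda>x. E x v)" by blast
  moreover from this mult.hyps have "\<forall>v. real_polynomial_function (\<lambda>x. f x * E x v + D x v * g x)"
    by (intro allI real_polynomial_function.intros(3,4)) blast+
  ultimately show ?case
    by (intro exI[of _ "\<lambda>x v. f x * E x v + D x v * g x"]) (simp add: has_derivative_mult)
qed

lemma Ck_on_real_polynomial_function: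
  fixes f :: "'a::euclidean_space \<Rightarrow> real"
  assumes "real_polynomial_function f"
  shows "Ck_on k f S"
  using assms
proof (induction k arbitrary: f)
  case 0
  then show ?case
    by (simp add: differentiable_on_real_polynomial_function differentiable_imp_continuous_on)
next
  case (Suc k)
  obtain D where D: "\<And>x. (f has_derivative D x) (at x)" "\<And>v. real_polynomial_function (\<lambda>x. D x v)"
    using real_polynomial_function_has_derivative[OF Suc.prems] by blast
  have "frechet_derivative f (at x) = D x" for x
    using frechet_derivative_at[OF D(1)] by simp
  then show ?case
    using Suc.IH D(2) Suc.prems by (simp add: differentiable_at_real_polynomial_function)
qed

text \<open>
  A subalgebra of the smooth functions that contains \<open>J\<close>, \<open>H\<close> and everything else to which a
  tangent vector has to be applied.  Membership is checked on all of \<open>\<complex>\<^sup>8\<close>, not only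
  on the level set, so that the closure properties are immediate.
\<close>

definition polynomial_functions :: "(point \<Rightarrow> real) set" where
  "polynomial_functions = {f. real_polynomial_function (f \<circ> orbit)}"

lemma polynomial_functions_smooth:
  assumes "f \<in> polynomial_functions"
  shows "f \<in> smooth_functions"
proof -
  have "smooth_on_open (f \<circ> orbit) UNIV"
    using assms Ck_on_real_polynomial_function[of "f \<circ> orbit"]
    by (simp add: polynomial_functions_def smooth_on_open_def)
  then show ?thesis
    unfolding smooth_functions_def smooth_on_subset_def by blast
qed

lemma polynomial_functions_const: "(\<lambda>p. c) \<in> polynomial_functions"
  by (simp add: polynomial_functions_def o_def real_polynomial_function.intros)

lemma polynomial_functions_add:
  "f \<in> polynomial_functions \<Longrightarrow> g \<in> polynomial_functions \<Longrightarrow> (\<lambda>p. f p + g p) \<in> polynomial_functions"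
  by (simp add: polynomial_functions_def o_def real_polynomial_function.intros)

lemma polynomial_functions_mult:
  "f \<in> polynomial_functions \<Longrightarrow> g \<in> polynomial_functions \<Longrightarrow> (\<lambda>p. f p * g p) \<in> polynomial_functions"
  by (simp add: polynomial_functions_def o_def real_polynomial_function.intros)

definition descend :: "(complex ^ 8 \<Rightarrow> real) \<Rightarrow> point \<Rightarrow> real" where
  "descend g p = the_elem (g ` p)"

lemma descend_orbit:
  assumes "\<And>t. g (torus_act t z) = g z"
  shows "descend g (orbit z) = g z"
proof -
  have "g ` orbit z = {g z}" using assms by (simp add: orbit_def image_image)
  then show ?thesis by (simp add: descend_def)
qed

lemma descend_polynomial:
  assumes "real_polynomial_function g" "\<And>t z. g (torus_act t z) = g z"
  shows "descend g \<in> polynomial_functions"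
proof -
  have "descend g \<circ> orbit = g" using descend_orbit[of g] assms(2) by auto
  then show ?thesis using assms(1) by (simp add: polynomial_functions_def)
qed

definition sq_norm :: "8 \<Rightarrow> point \<Rightarrow> real" where
  "sq_norm k = descend (\<lambda>z. (cmod (z $ k))\<^sup>2)"

lemma sq_norm_orbit: "sq_norm k (orbit z) = (cmod (z $ k))\<^sup>2"
  by (simp add: sq_norm_def descend_orbit norm_torus_act)

lemma real_polynomial_function_coordinate [intro]:
  "real_polynomial_function (\<lambda>z :: complex ^ 'n. Re (z $ k))"
  "real_polynomial_function (\<lambda>z :: complex ^ 'n. Im (z $ k))"
  by (intro real_polynomial_function.intros(1) bounded_linear_compose[OF bounded_linear_Re]
        bounded_linear_compose[OF bounded_linear_Im] bounded_linear_vec_nth)+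

lemma real_polynomial_function_sq_norm:
  "real_polynomial_function (\<lambda>z :: complex ^ 'n. (cmod (z $ k))\<^sup>2)"
  unfolding cmod_power2
  by (intro real_polynomial_function.intros(3) real_polynomial_function_power
      real_polynomial_function_coordinate)

lemma sq_norm_polynomial: "sq_norm k \<in> polynomial_functions"
  unfolding sq_norm_def
  by (intro descend_polynomial real_polynomial_function_sq_norm) (simp add: norm_torus_act)

lemma J_fun_eq: "J_fun (orbit z) = (cmod (z $ 1))\<^sup>2 / 2"
  using descend_orbit[of "\<lambda>z. (cmod (z $ 1))\<^sup>2 / 2" z] by (simp add: J_fun_def descend_def norm_torus_act)

lemma H_fun_eq: "H_fun (orbit z) = (cmod (z $ 3))\<^sup>2 / 2"
  using descend_orbit[of "\<lambda>z. (cmod (z $ 3))\<^sup>2 / 2" z] by (simp add: H_fun_def descend_def norm_torus_act)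

section \<open>Invariant monomials\<close>

text \<open>
  Powers with negative exponents use the conjugate instead of the inverse.  On the unit circle there is
  no difference, so invariance under rotations is not affected, but the result stays polynomial.
\<close>

definition signed_power :: "int \<Rightarrow> complex \<Rightarrow> complex" where
  "signed_power e x = (if e \<ge> 0 then x ^ nat e else cnj x ^ nat (- e))"

lemma signed_power_mult: "signed_power e (x * y) = signed_power e x * signed_power e y"
  by (simp add: signed_power_def power_mult_distrib)

lemma signed_power_cis: "signed_power e (cis t) = cis (of_int e * t)"
  by (simp add: signed_power_def Complex.DeMoivre cis_cnj)

lemma norm_signed_power: "cmod (signed_power e x) = cmod x ^ nat \<bar>e\<bar>"
  by (simp add: signed_power_def norm_power)

definition monomial :: "int \<Rightarrow> int \<Rightarrow> complex ^ 8 \<Rightarrow> complex" where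
  "monomial p q z = (\<Prod>k\<in>UNIV. signed_power (pairing p q k) (z $ k))"

lemma prod_cis: "finite S \<Longrightarrow> (\<Prod>k\<in>S. cis (f k)) = cis (\<Sum>k\<in>S. f k)"
  by (induction rule: finite_induct) (auto simp: cis_mult)

text \<open>
  The rotation angles are orthogonal to both vectors of normal components, and the exponents
  are a combination of these vectors.
\<close>

lemma monomial_invariant: "monomial p q (torus_act t z) = monomial p q z"
proof -
  have "(\<Sum>k\<in>UNIV. of_int (pairing p q k) * weight t k) =
      of_int p * (\<Sum>k\<in>UNIV. of_int (normal_x $ k) * weight t k) +
      of_int q * (\<Sum>k\<in>UNIV. of_int (normal_y $ k) * weight t k)"
    by (simp add: pairing_def sum_distrib_left sum.distrib algebra_simps)
  then have "(\<Sum>k\<in>UNIV. of_int (pairing p q k) * weight t k) = 0"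
    by (simp add: weight_balanced)
  then show ?thesis
    by (simp add: monomial_def torus_act_nth signed_power_mult signed_power_cis prod.distrib prod_cis)
qed

text \<open>Polynomials in the coordinates and their conjugates.\<close>

definition complex_polynomial :: "('a::real_normed_vector \<Rightarrow> complex) \<Rightarrow> bool" where
  "complex_polynomial h \<longleftrightarrow>
     real_polynomial_function (\<lambda>z. Re (h z)) \<and> real_polynomial_function (\<lambda>z. Im (h z))"

lemma complex_polynomial_mult:
  "complex_polynomial g \<Longrightarrow> complex_polynomial h \<Longrightarrow> complex_polynomial (\<lambda>z. g z * h z)"
  by (auto simp: complex_polynomial_def
      intro!: real_polynomial_function_diff real_polynomial_function.intros(3,4))

lemma complex_polynomial_power: "complex_polynomial h \<Longrightarrow> complex_polynomial (\<lambda>z. h z ^ n)"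
  by (induction n) (auto intro: complex_polynomial_mult simp: complex_polynomial_def[of "\<lambda>z. 1"])

lemma complex_polynomial_prod:
  "finite S \<Longrightarrow> (\<And>k. complex_polynomial (\<lambda>z. h z k)) \<Longrightarrow> complex_polynomial (\<lambda>z. \<Prod>k\<in>S. h z k)"
  by (induction rule: finite_induct)
    (auto intro!: complex_polynomial_mult simp: complex_polynomial_def[of "\<lambda>z. 1"])

lemma complex_polynomial_coordinate:
  "complex_polynomial (\<lambda>z :: complex ^ 'n. z $ k)"
  "complex_polynomial (\<lambda>z :: complex ^ 'n. cnj (z $ k))"
  by (auto simp: complex_polynomial_def)

lemma complex_polynomial_monomial: "complex_polynomial (monomial p q)"
proof -
  have "complex_polynomial (\<lambda>z. signed_power e (z $ k))" for e and k :: 8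
    by (cases "e \<ge> 0")
      (auto simp: signed_power_def intro!: complex_polynomial_power complex_polynomial_coordinate)
  then have "complex_polynomial (\<lambda>z. \<Prod>k\<in>UNIV. signed_power (pairing p q k) (z $ k))"
    by (intro complex_polynomial_prod) auto
  then show ?thesis by (simp add: monomial_def[abs_def])
qed

section \<open>The vertices are critical\<close>

text \<open>
  The following rules restate the axioms of a derivation for polynomial functions, for which the
  smoothness hypotheses are available.
\<close>

lemma tangent_mult:
  assumes "X \<in> tangent_space p" "f \<in> polynomial_functions" "g \<in> polynomial_functions"
  shows "X (\<lambda>q. f q * g q) = f p * X g + g p * X f"
  using assms polynomial_functions_smooth unfolding tangent_space_def by blast

lemma tangent_linear:
  assumes "X \<in> tangent_space p" "f \<in> polynomial_functions" "g \<in> polynomial_functions"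
  shows "X (\<lambda>q. a * f q + b * g q) = a * X f + b * X g"
  using assms polynomial_functions_smooth unfolding tangent_space_def by blast

lemma tangent_cong:
  assumes "X \<in> tangent_space p" "f \<in> polynomial_functions" "g \<in> polynomial_functions"
    and "\<And>z. z \<in> level_set \<Longrightarrow> f (orbit z) = g (orbit z)"
  shows "X f = X g"
proof -
  have "\<forall>q\<in>quotient_manifold. f q = g q" using assms(4) by (auto simp: quotient_manifold_def)
  then show ?thesis
    using assms polynomial_functions_smooth unfolding tangent_space_def by blast
qed

lemma tangent_const:
  assumes X: "X \<in> tangent_space p"
  shows "X (\<lambda>q. c) = 0"
proof -
  \<comment> \<open>The product rule for \<open>1 = 1 * 1\<close>.\<close>
  have one: "X (\<lambda>q. 1) = 0"
    using tangent_mult[OF X polynomial_functions_const[of 1] polynomial_functions_const[of 1]] by simp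
  show ?thesis
    using tangent_linear[OF X polynomial_functions_const[of 1] polynomial_functions_const[of 1], of c 0] one by simp
qed

lemma tangent_affine:
  assumes X: "X \<in> tangent_space p" and f: "f \<in> polynomial_functions"
    and g: "g \<in> polynomial_functions" and h: "h \<in> polynomial_functions"
    and eq: "\<And>z. z \<in> level_set \<Longrightarrow> f (orbit z) = c + a * g (orbit z) + b * h (orbit z)"
  shows "X f = a * X g + b * X h"
proof -
  have lin: "(\<lambda>q. a * g q + b * h q) \<in> polynomial_functions"
    by (intro polynomial_functions_add polynomial_functions_mult polynomial_functions_const g h)
  have "X f = X (\<lambda>q. 1 * (a * g q + b * h q) + c * 1)"
    by (rule tangent_cong[OF X f])
      (intro polynomial_functions_add polynomial_functions_mult polynomial_functions_const g h,
       simp add: eq)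
  also have "\<dots> = 1 * X (\<lambda>q. a * g q + b * h q) + c * X (\<lambda>q. 1)"
    by (rule tangent_linear[OF X lin polynomial_functions_const])
  finally show ?thesis
    by (simp add: tangent_const[OF X] tangent_linear[OF X g h])
qed

text \<open>
  The product rule gives \<open>X (u\<^sup>2 + v\<^sup>2) = 0\<close> where \<open>u\<close> and \<open>v\<close> vanish, and \<open>X (f g) = g X f\<close>
  where \<open>f\<close> vanishes.
\<close>

lemma tangent_eq_0_if_mult_sum_squares:
  assumes X: "X \<in> tangent_space p"
    and poly: "f \<in> polynomial_functions" "g \<in> polynomial_functions"
      "u \<in> polynomial_functions" "v \<in> polynomial_functions"
    and eq: "\<And>z. z \<in> level_set \<Longrightarrow> f (orbit z) * g (orbit z) = u (orbit z) * u (orbit z) + v (orbit z) * v (orbit z)"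
    and zero: "u p = 0" "v p = 0" "f p = 0" and "g p \<noteq> 0"
  shows "X f = 0"
proof -
  have "X (\<lambda>q. f q * g q) = 1 * X (\<lambda>q. u q * u q) + 1 * X (\<lambda>q. v q * v q)"
    by (rule tangent_affine[OF X, where c = 0])
      (intro polynomial_functions_mult poly | simp add: eq)+
  then have "g p * X f = 0"
    using zero by (simp add: tangent_mult[OF X] poly)
  then show ?thesis using \<open>g p \<noteq> 0\<close> by simp
qed

text \<open>
  The hypotheses say that \<open>z\<^sub>i\<close> enters the invariant monomial to the first power and that none of its
  other factors vanishes at \<open>w\<close>.  So the squared modulus of the monomial is \<open>\<bar>z\<^sub>i\<bar>\<^sup>2\<close> times
  an invariant that is not zero at \<open>w\<close>.
\<close>

lemma tangent_sq_norm_eq_0: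
  assumes X: "X \<in> tangent_space (orbit w)"
    and i: "w $ i = 0" "\<bar>pairing p q i\<bar> = 1"
    and others: "\<And>k. k \<noteq> i \<Longrightarrow> w $ k = 0 \<Longrightarrow> pairing p q k = 0"
  shows "X (sq_norm i) = 0"
proof -
  define cofactor where
    "cofactor z = (\<Prod>k\<in>UNIV - {i}. (cmod (z $ k))\<^sup>2 ^ nat \<bar>pairing p q k\<bar>)" for z :: "complex ^ 8"
  have norm_monomial: "(cmod (z $ i))\<^sup>2 * cofactor z = (cmod (monomial p q z))\<^sup>2" for z
  proof -
    have "(cmod (monomial p q z))\<^sup>2 = (\<Prod>k\<in>UNIV. (cmod (z $ k))\<^sup>2 ^ nat \<bar>pairing p q k\<bar>)"
      by (simp add: monomial_def norm_signed_power prod_norm[symmetric] prod_power_distrib power_commutes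
          flip: power_mult power_mult_distrib) (simp add: mult.commute)
    also have "\<dots> = (cmod (z $ i))\<^sup>2 ^ nat \<bar>pairing p q i\<bar> * cofactor z"
      unfolding cofactor_def by (rule prod.remove) auto
    finally show ?thesis using i(2) by simp
  qed
  have sum_squares: "(cmod (z $ i))\<^sup>2 * cofactor z =
      Re (monomial p q z) * Re (monomial p q z) + Im (monomial p q z) * Im (monomial p q z)" for z
    unfolding norm_monomial unfolding cmod_power2 by (simp add: power2_eq_square)
  have cofactor_invariant: "cofactor (torus_act t z) = cofactor z" for t z
    by (simp add: cofactor_def norm_torus_act)
  have "real_polynomial_function cofactor"
    unfolding cofactor_def
    by (rule real_polynomial_function_prod, simp)
      (rule real_polynomial_function_power[OF real_polynomial_function_sq_norm])
  then have cofactor_polynomial: "descend cofactor \<in> polynomial_functions"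
    by (intro descend_polynomial cofactor_invariant)
  have parts: "descend (\<lambda>z. Re (monomial p q z)) \<in> polynomial_functions"
    "descend (\<lambda>z. Im (monomial p q z)) \<in> polynomial_functions"
    using complex_polynomial_monomial[of p q]
    by (auto intro!: descend_polynomial simp: monomial_invariant complex_polynomial_def)
  have monomial_zero: "monomial p q w = 0"
    using norm_monomial[of w] i(1) by simp
  show ?thesis
  proof (rule tangent_eq_0_if_mult_sum_squares[OF X sq_norm_polynomial cofactor_polynomial parts])
    show "descend cofactor (orbit w) \<noteq> 0"
      using others by (auto simp: descend_orbit[OF cofactor_invariant]) (auto simp: cofactor_def)
  qed (simp_all add: descend_orbit monomial_invariant cofactor_invariant sq_norm_orbit sum_squares
      monomial_zero i(1))
qed

lemma tangent_sq_norm: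
  assumes X: "X \<in> tangent_space p"
  shows "X (sq_norm k) = of_int (normal_x $ k) * X (sq_norm 1) + of_int (normal_y $ k) * X (sq_norm 3)"
  by (rule tangent_affine[OF X, where c = "offset $ k"])
    (auto simp: sq_norm_orbit intro!: sq_norm_polynomial level_setD)

lemma quotient_manifoldI: "z \<in> level_set \<Longrightarrow> orbit z \<in> quotient_manifold"
  by (simp add: quotient_manifold_def)

lemma fst_F_map: "fst \<circ> F_map = J_fun" and snd_F_map: "snd \<circ> F_map = H_fun"
  by (auto simp: F_map_def)

lemma J_H_polynomial: "J_fun \<in> polynomial_functions" "H_fun \<in> polynomial_functions"
proof -
  have "J_fun \<circ> orbit = (\<lambda>z. (cmod (z $ 1))\<^sup>2 / 2)" "H_fun \<circ> orbit = (\<lambda>z. (cmod (z $ 3))\<^sup>2 / 2)"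
    by (auto simp: J_fun_eq H_fun_eq)
  then show "J_fun \<in> polynomial_functions" "H_fun \<in> polynomial_functions"
    unfolding polynomial_functions_def mem_Collect_eq
    by (simp_all only: real_polynomial_function_divide real_polynomial_function_sq_norm)
qed

text \<open>
  Pairing with \<open>(p, q) = (normal_y $ j, - normal_x $ j)\<close> gives the determinant of \<open>n\<^sub>i, n\<^sub>j\<close>, that is
  \<open>\<plusminus>1\<close>, on \<open>n\<^sub>i\<close> and \<open>0\<close> on \<open>n\<^sub>j\<close>.  The corresponding invariant monomial contains \<open>z\<^sub>i\<close> to
  the first power and does not contain \<open>z\<^sub>j\<close>; this is where the Delzant condition on the octagon
  enters.
\<close>

lemma vertex_fixed:
  assumes w: "w \<in> level_set" "w $ i = 0" "w $ j = 0"
    and others: "\<And>k. w $ k = 0 \<Longrightarrow> k = i \<or> k = j" and det: "\<bar>facet_det i j\<bar> = 1"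
  shows "orbit w \<in> fixed_points F_map"
proof -
  have "differential F_map X = 0" if X: "X \<in> tangent_space (orbit w)" for X
  proof -
    define a b where "a = X (sq_norm 1)" and "b = X (sq_norm 3)"
    have "X (sq_norm i) = 0"
      by (rule tangent_sq_norm_eq_0[OF X w(2), of "normal_y $ j" "- normal_x $ j"])
        (use others det in \<open>auto simp: pairing_def facet_det_def algebra_simps\<close>)
    then have i: "of_int (normal_x $ i) * a + of_int (normal_y $ i) * b = 0"
      using tangent_sq_norm[OF X, of i] by (simp add: a_def b_def)
    have "X (sq_norm j) = 0"
      by (rule tangent_sq_norm_eq_0[OF X w(3), of "normal_y $ i" "- normal_x $ i"])
        (use others det in \<open>auto simp: pairing_def facet_det_def algebra_simps\<close>)
    then have j: "of_int (normal_x $ j) * a + of_int (normal_y $ j) * b = 0"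
      using tangent_sq_norm[OF X, of j] by (simp add: a_def b_def)
    have "a = 0" "b = 0"
      using independent_normals_solve[OF _ i j] det by auto
    moreover have "X J_fun = 1/2 * X (sq_norm 1) + 0 * X (sq_norm 1)"
      by (rule tangent_affine[OF X, where c = 0])
        (auto intro!: J_H_polynomial sq_norm_polynomial simp: J_fun_eq sq_norm_orbit)
    moreover have "X H_fun = 1/2 * X (sq_norm 3) + 0 * X (sq_norm 1)"
      by (rule tangent_affine[OF X, where c = 0])
        (auto intro!: J_H_polynomial sq_norm_polynomial simp: H_fun_eq sq_norm_orbit)
    ultimately show ?thesis
      by (simp add: differential_def fst_F_map snd_F_map a_def b_def zero_prod_def)
  qed
  then show ?thesis
    using w(1) by (simp add: fixed_points_def quotient_manifoldI)
qed

section \<open>Every other point is regular\<close>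

text \<open>
  Near \<open>\<gamma> 0\<close> the pullback of a smooth function extends to a differentiable function \<open>g\<close> on an open
  set, so it can be differentiated along the curve by the chain rule.
\<close>

lemma curve_derivation:
  fixes \<gamma> :: "real \<Rightarrow> complex ^ 8"
  assumes diff: "\<gamma> differentiable (at 0)" and in_level: "\<forall>\<^sub>F s in nhds 0. \<gamma> s \<in> level_set"
  shows "(\<lambda>f. deriv (\<lambda>s. f (orbit (\<gamma> s))) 0) \<in> tangent_space (orbit (\<gamma> 0))"
proof -
  have 0: "\<gamma> 0 \<in> level_set" using eventually_nhds_x_imp_x[OF in_level] .
  have deriv: "((\<lambda>s. f (orbit (\<gamma> s))) has_real_derivative deriv (\<lambda>s. f (orbit (\<gamma> s))) 0) (at 0)"
    if f: "f \<in> smooth_functions" for f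
  proof -
    from f have "\<exists>U g. \<gamma> 0 \<in> U \<and> smooth_on_open g U \<and> (\<forall>x\<in>U \<inter> level_set. g x = (f \<circ> orbit) x)"
      using 0 by (simp only: smooth_functions_def smooth_on_subset_def mem_Collect_eq)
    then obtain U g where U: "\<gamma> 0 \<in> U" and g: "smooth_on_open g U"
      and gf: "\<forall>x\<in>U \<inter> level_set. g x = (f \<circ> orbit) x" by (elim exE conjE)
    have "open U" "Ck_on (Suc 0) g U" using g by (simp_all only: smooth_on_open_def)
    have "g differentiable at (\<gamma> 0)" using U \<open>Ck_on (Suc 0) g U\<close> by simp
    then have "(g \<circ> \<gamma>) differentiable at 0" by (rule differentiable_chain_at[OF diff])
    then obtain D where D: "((g \<circ> \<gamma>) has_real_derivative D) (at 0)"
      using real_differentiable_def by blast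
    have "isCont \<gamma> 0" by (rule differentiable_imp_continuous_within[OF diff])
    then have "(\<gamma> \<longlongrightarrow> \<gamma> 0) (nhds 0)" by (simp add: isCont_def tendsto_at_iff_tendsto_nhds)
    then have "\<forall>\<^sub>F s in nhds 0. \<gamma> s \<in> U"
      using \<open>open U\<close> U by (rule topological_tendstoD)
    then have "\<forall>\<^sub>F s in nhds 0. (g \<circ> \<gamma>) s = f (orbit (\<gamma> s))"
      using in_level by eventually_elim (simp add: gf)
    then have "((\<lambda>s. f (orbit (\<gamma> s))) has_real_derivative D) (at 0)"
      using D by (subst DERIV_cong_ev[OF refl _ refl, symmetric])
    then show ?thesis by (simp add: DERIV_imp_deriv)
  qed
  show ?thesis
    unfolding tangent_space_def mem_Collect_eq
  proof (intro conjI ballI allI impI)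
    fix f g assume "f \<in> smooth_functions" "g \<in> smooth_functions" and eq: "\<forall>q\<in>quotient_manifold. f q = g q"
    have "\<forall>\<^sub>F s in nhds 0. f (orbit (\<gamma> s)) = g (orbit (\<gamma> s))"
      using in_level by eventually_elim (rule eq[rule_format, OF quotient_manifoldI])
    then show "deriv (\<lambda>s. f (orbit (\<gamma> s))) 0 = deriv (\<lambda>s. g (orbit (\<gamma> s))) 0"
      by (rule deriv_cong_ev) (rule refl)
  next
    fix f g and a b :: real assume fg: "f \<in> smooth_functions" "g \<in> smooth_functions"
    show "deriv (\<lambda>s. a * f (orbit (\<gamma> s)) + b * g (orbit (\<gamma> s))) 0 =
        a * deriv (\<lambda>s. f (orbit (\<gamma> s))) 0 + b * deriv (\<lambda>s. g (orbit (\<gamma> s))) 0"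
      by (rule DERIV_imp_deriv[OF DERIV_add[OF DERIV_cmult[OF deriv[OF fg(1)]] DERIV_cmult[OF deriv[OF fg(2)]]]])
  next
    fix f g assume fg: "f \<in> smooth_functions" "g \<in> smooth_functions"
    show "deriv (\<lambda>s. f (orbit (\<gamma> s)) * g (orbit (\<gamma> s))) 0 =
        f (orbit (\<gamma> 0)) * deriv (\<lambda>s. g (orbit (\<gamma> s))) 0 + g (orbit (\<gamma> 0)) * deriv (\<lambda>s. f (orbit (\<gamma> s))) 0"
      using DERIV_imp_deriv[OF DERIV_mult[OF deriv[OF fg(1)] deriv[OF fg(2)]]] by (simp add: mult.commute)
  qed
qed

text \<open>
  The curve that starts at \<open>w\<close> and changes \<open>\<bar>w\<^sub>k\<bar>\<^sup>2\<close> with constant velocity \<open>n\<^sub>k \<cdot> (p, q)\<close>.  Where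
  \<open>w\<^sub>k = 0\<close> the quotient has the default value \<open>0\<close>, and the coordinate stays \<open>0\<close>.
\<close>

definition rescaling :: "int \<Rightarrow> int \<Rightarrow> complex ^ 8 \<Rightarrow> real \<Rightarrow> complex ^ 8" where
  "rescaling p q w s = (\<chi> k. sqrt (1 + s * of_int (pairing p q k) / (cmod (w $ k))\<^sup>2) *\<^sub>R w $ k)"

lemma rescaling_0: "rescaling p q w 0 = w"
  by (simp add: rescaling_def vec_eq_iff)

lemma rescaling_differentiable: "rescaling p q w differentiable (at 0)"
proof -
  have "(\<lambda>s. sqrt (1 + s * a / b)) differentiable (at 0)" for a b :: real
  proof -
    have "((\<lambda>s. sqrt (1 + s * a / b)) has_real_derivative (a / b / 2)) (at 0)"
      by (cases "b = 0") (auto intro!: derivative_eq_intros)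
    then show ?thesis using real_differentiable_def by blast
  qed
  then show ?thesis
    by (subst differentiable_componentwise_within) (auto simp: rescaling_def Basis_vec_def inner_axis)
qed

lemma eventually_norm_rescaling:
  assumes "\<forall>k. w $ k = 0 \<longrightarrow> pairing p q k = 0"
  shows "\<forall>\<^sub>F s in nhds 0. \<forall>k. (cmod (rescaling p q w s $ k))\<^sup>2 = (cmod (w $ k))\<^sup>2 + s * of_int (pairing p q k)"
proof (rule eventually_all_finite)
  fix k
  define c where "c = of_int (pairing p q k) / (cmod (w $ k))\<^sup>2"
  have "((\<lambda>s. 1 + s * c) \<longlongrightarrow> 1 + 0 * c) (nhds 0)"
    by (intro tendsto_intros filterlim_ident)
  then have "\<forall>\<^sub>F s in nhds 0. 1 + s * c > 0" by (rule order_tendstoD) simp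
  then show "\<forall>\<^sub>F s in nhds 0. (cmod (rescaling p q w s $ k))\<^sup>2 = (cmod (w $ k))\<^sup>2 + s * of_int (pairing p q k)"
  proof eventually_elim
    case (elim s)
    have "(cmod (rescaling p q w s $ k))\<^sup>2 = (1 + s * c) * (cmod (w $ k))\<^sup>2"
    proof -
      have "rescaling p q w s $ k = sqrt (1 + s * c) *\<^sub>R w $ k"
        by (simp add: rescaling_def c_def)
      then show ?thesis using elim by (simp add: power_mult_distrib)
    qed
    also have "\<dots> = (cmod (w $ k))\<^sup>2 + s * of_int (pairing p q k)"
      using assms by (cases "w $ k = 0") (simp_all add: c_def distrib_right)
    finally show ?case .
  qed
qed

text \<open>
  The squared moduli move along the affine relations that define the level set.
\<close>

lemma eventually_rescaling_in_level_set:
  assumes "w \<in> level_set" "\<forall>k. w $ k = 0 \<longrightarrow> pairing p q k = 0"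
  shows "\<forall>\<^sub>F s in nhds 0. rescaling p q w s \<in> level_set"
  using eventually_norm_rescaling[OF assms(2)]
proof eventually_elim
  case (elim s)
  have "pairing p q 1 = p" "pairing p q 3 = q"
    by (simp_all add: pairing_def normal_x_def normal_y_def)
  then have level: "(cmod (rescaling p q w s $ k))\<^sup>2 = offset $ k + of_int (normal_x $ k) * (cmod (rescaling p q w s $ 1))\<^sup>2 +
      of_int (normal_y $ k) * (cmod (rescaling p q w s $ 3))\<^sup>2" for k
    unfolding elim[rule_format] level_setD[OF assms(1), of k]
    by (simp add: pairing_def algebra_simps)
  show ?case unfolding level_set_iff by (intro allI level)
qed

lemma not_fixed_if_direction:
  assumes w: "w \<in> level_set" "\<forall>k. w $ k = 0 \<longrightarrow> pairing p q k = 0" and "(p, q) \<noteq> (0, 0)"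
  shows "orbit w \<notin> fixed_points F_map"
proof
  assume fixed: "orbit w \<in> fixed_points F_map"
  define X where "X f = deriv (\<lambda>s. f (orbit (rescaling p q w s))) 0" for f :: "point \<Rightarrow> real"
  have "X \<in> tangent_space (orbit w)"
    using curve_derivation[OF rescaling_differentiable eventually_rescaling_in_level_set[OF w]]
    unfolding X_def[abs_def] rescaling_0 .
  then have zero: "X J_fun = 0" "X H_fun = 0"
    using fixed by (auto simp: fixed_points_def differential_def fst_F_map snd_F_map zero_prod_def)
  have pq: "pairing p q 1 = p" "pairing p q 3 = q"
    by (simp_all add: pairing_def normal_x_def normal_y_def)
  have affine: "deriv (\<lambda>s. (a + s * b) / 2) 0 = b / 2" for a b :: real
    by (rule DERIV_imp_deriv) (auto intro!: derivative_eq_intros)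
  note norms = eventually_norm_rescaling[OF w(2)]
  have "X J_fun = deriv (\<lambda>s. ((cmod (w $ 1))\<^sup>2 + s * of_int p) / 2) 0"
    unfolding X_def
    by (rule deriv_cong_ev[OF _ refl], use norms in eventually_elim) (simp add: J_fun_eq pq)
  moreover have "X H_fun = deriv (\<lambda>s. ((cmod (w $ 3))\<^sup>2 + s * of_int q) / 2) 0"
    unfolding X_def
    by (rule deriv_cong_ev[OF _ refl], use norms in eventually_elim) (simp add: H_fun_eq pq)
  ultimately show False using zero \<open>(p, q) \<noteq> (0, 0)\<close> by (simp add: affine)
qed

text \<open>
  If \<open>z\<^sub>i\<close> is the only coordinate that vanishes, one can still move along the \<open>i\<close>-th edge; if none
  vanishes, one can move in any direction.
\<close>

lemma fixed_imp_two_zeros: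
  assumes w: "w \<in> level_set" and fixed: "orbit w \<in> fixed_points F_map"
  obtains i j where "i \<noteq> j" "w $ i = 0" "w $ j = 0"
proof (rule ccontr)
  assume "\<not> thesis"
  with that have single: "\<And>i j. w $ i = 0 \<Longrightarrow> w $ j = 0 \<Longrightarrow> i = j" by blast
  show False
  proof (cases "\<exists>i. w $ i = 0")
    case True
    then obtain i where i: "w $ i = 0" by blast
    have "\<forall>k. (normal_y $ k, - normal_x $ k) \<noteq> (0, 0)"
      unfolding forall_8 by (simp add: normal_x_def normal_y_def)
    then have nonzero: "(normal_y $ i, - normal_x $ i) \<noteq> (0, 0)" ..
    have "\<forall>k. w $ k = 0 \<longrightarrow> pairing (normal_y $ i) (- normal_x $ i) k = 0"
      using single[OF i] by (auto simp: pairing_def)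
    then show False using not_fixed_if_direction[OF w _ nonzero] fixed by blast
  next
    case False
    then show False using not_fixed_if_direction[OF w, of 1 0] fixed by auto
  qed
qed

section \<open>The eight vertices\<close>

text \<open>
  The facts that the final theorem states separately for each of the eight points, together with
  the uniqueness of the point over the vertex.
\<close>

definition is_vertex :: "8 \<Rightarrow> 8 \<Rightarrow> point \<Rightarrow> real \<times> real \<Rightarrow> bool" where
  "is_vertex i j p v \<longleftrightarrow>
     p \<in> fixed_points F_map \<and> F_map p = v \<and> (\<forall>z\<in>p. z $ i = 0 \<and> z $ j = 0) \<and>
     (\<forall>w\<in>level_set. w $ i = 0 \<and> w $ j = 0 \<longrightarrow> orbit w = p)"

lemma is_vertex_point_of:
  assumes "vector (map complex_of_real xs) = r" and r: "r \<in> level_set"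
    and zeros: "\<forall>k. r $ k = 0 \<longleftrightarrow> k = i \<or> k = j" and det: "\<bar>facet_det i j\<bar> = 1"
    and v: "v = ((cmod (r $ 1))\<^sup>2 / 2, (cmod (r $ 3))\<^sup>2 / 2)"
  shows "is_vertex i j (point_of xs) v"
proof -
  have p: "point_of xs = orbit r" using assms(1) by (simp add: point_of_def)
  have z: "r $ i = 0" "r $ j = 0" using zeros by auto
  have "orbit w = orbit r" if "w \<in> level_set" "w $ i = 0" "w $ j = 0" for w
    using that det
    by (intro orbit_eq_if_two_zeros[OF norms_eq_if_two_zeros[OF that r z] z]) auto
  then show ?thesis
    unfolding is_vertex_def p
    using vertex_fixed[OF r z _ det] zeros v zero_in_orbit_iff[of _ r]
    by (auto simp: F_map_def J_fun_eq H_fun_eq)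
qed

lemma vertices:
  "is_vertex 1 2 P_min (0, 1)"
  "is_vertex 2 3 pt_B (1, 0)"
  "is_vertex 3 4 pt_D (2, 0)"
  "is_vertex 4 5 Q_min (3, 1)"
  "is_vertex 5 6 Q_max (3, 2)"
  "is_vertex 6 7 pt_C (2, 3)"
  "is_vertex 7 8 pt_A (1, 3)"
  "is_vertex 8 1 P_max (0, 2)"
  unfolding P_min_def pt_B_def pt_D_def Q_min_def Q_max_def pt_C_def pt_A_def P_max_def
  by (rule is_vertex_point_of[OF refl];
      simp add: level_set_def facet_det_def normal_x_def normal_y_def power_mult_distrib norm_mult forall_8)+

lemma is_vertexD:
  assumes "is_vertex i j p v"
  shows "p \<in> fixed_points F_map" "F_map p = v"
    "w \<in> level_set \<Longrightarrow> w $ i = 0 \<Longrightarrow> w $ j = 0 \<Longrightarrow> orbit w = p"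
    "z \<in> p \<Longrightarrow> z $ i = 0" "z \<in> p \<Longrightarrow> z $ j = 0"
  using assms unfolding is_vertex_def by blast+

lemma fixed_points_eq:
  "fixed_points F_map = {P_min, pt_B, pt_D, Q_min, Q_max, pt_C, pt_A, P_max}"
proof
  show "{P_min, pt_B, pt_D, Q_min, Q_max, pt_C, pt_A, P_max} \<subseteq> fixed_points F_map"
    using vertices[THEN is_vertexD(1)] by (simp only: insert_subset empty_subsetI simp_thms)
  show "fixed_points F_map \<subseteq> {P_min, pt_B, pt_D, Q_min, Q_max, pt_C, pt_A, P_max}"
  proof
    fix p assume p: "p \<in> fixed_points F_map"
    then obtain w where w: "w \<in> level_set" "p = orbit w"
      unfolding fixed_points_def quotient_manifold_def by blast
    obtain i j where "i \<noteq> j" "w $ i = 0" "w $ j = 0"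
      by (rule fixed_imp_two_zeros[OF w(1) p[unfolded w(2)]])
    from zero_pairs_adjacent[OF w(1) this(2,3,1)]
    show "p \<in> {P_min, pt_B, pt_D, Q_min, Q_max, pt_C, pt_A, P_max}"
      by (elim disjE conjE) (simp_all add: w(2) vertices[THEN is_vertexD(3), OF w(1)])
  qed
qed

lemma with_zeros_eq:
  assumes "is_vertex i j p v"
  shows "with_zeros i j (fixed_points F_map) = {p}"
proof -
  have "q = p" if q: "q \<in> fixed_points F_map" "\<forall>z\<in>q. z $ i = 0 \<and> z $ j = 0" for q
  proof -
    obtain w where w: "w \<in> level_set" "q = orbit w"
      using q(1) unfolding fixed_points_def quotient_manifold_def by blast
    have "w $ i = 0 \<and> w $ j = 0"
      using q(2) self_in_orbit[of w] unfolding w(2) by (rule bspec)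
    then show ?thesis unfolding w(2) by (intro is_vertexD(3)[OF assms w(1)]) simp_all
  qed
  moreover have "p \<in> with_zeros i j (fixed_points F_map)"
    unfolding with_zeros_def using is_vertexD[OF assms] by simp
  ultimately show ?thesis
    unfolding with_zeros_def by blast
qed

section \<open>The octagon\<close>

lemma extreme_point_if_separated:
  fixes v a :: "'a::euclidean_space"
  assumes "finite S" "a \<bullet> v < b" "\<And>x. x \<in> S \<Longrightarrow> b \<le> a \<bullet> x"
  shows "v extreme_point_of (convex hull (insert v S))"
proof (rule extreme_point_of_convex_hull_insert[OF assms(1)])
  have "convex hull S \<subseteq> {x. b \<le> a \<bullet> x}"
    by (rule hull_minimal) (use assms(3) convex_halfspace_ge[of b a] in auto)
  then show "v \<notin> convex hull S" using assms(2) by auto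
qed

text \<open>
  Each vertex is separated from the other seven by a linear functional: the sum of the inward
  normals of its two edges, whose value at the vertex is smaller by at least \<open>1\<close> than at the
  others.
\<close>

lemma extreme_points_octagon:
  "{v. v extreme_point_of octagon} =
     {(0, 1), (1, 0), (2, 0), (3, 1), (3, 2), (2, 3), (1, 3), (0, 2)}" (is "_ = ?V")
proof
  show "{v. v extreme_point_of octagon} \<subseteq> ?V"
    unfolding octagon_def using extreme_point_of_convex_hull by blast
  have separated: "v extreme_point_of octagon" if "v \<in> ?V" "\<forall>x\<in>?V. x \<noteq> v \<longrightarrow> a \<bullet> v + 1 \<le> a \<bullet> x" for v a
  proof -
    have "insert v (?V - {v}) = ?V" using that(1) by blast
    moreover have "v extreme_point_of (convex hull (insert v (?V - {v})))"
      by (rule extreme_point_if_separated[of _ a _ "a \<bullet> v + 1"]) (use that(2) in auto)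
    ultimately show ?thesis by (simp add: octagon_def)
  qed
  have "(0, 1) extreme_point_of octagon" by (rule separated[of _ "(2, 1)"]) simp_all
  moreover have "(1, 0) extreme_point_of octagon" by (rule separated[of _ "(1, 2)"]) simp_all
  moreover have "(2, 0) extreme_point_of octagon" by (rule separated[of _ "(- 1, 2)"]) simp_all
  moreover have "(3, 1) extreme_point_of octagon" by (rule separated[of _ "(- 2, 1)"]) simp_all
  moreover have "(3, 2) extreme_point_of octagon" by (rule separated[of _ "(- 2, - 1)"]) simp_all
  moreover have "(2, 3) extreme_point_of octagon" by (rule separated[of _ "(- 1, - 2)"]) simp_all
  moreover have "(1, 3) extreme_point_of octagon" by (rule separated[of _ "(1, - 2)"]) simp_all
  moreover have "(0, 2) extreme_point_of octagon" by (rule separated[of _ "(2, - 1)"]) simp_all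
  ultimately show "?V \<subseteq> {v. v extreme_point_of octagon}" by simp
qed

section \<open>The fixed points of the integrable system\<close>

theorem proposition3p7:
  shows "fixed_points F_map = {P_min, pt_B, pt_D, Q_min, Q_max, pt_C, pt_A, P_max}
    \<and> distinct [P_min, pt_B, pt_D, Q_min, Q_max, pt_C, pt_A, P_max]
    \<and> with_zeros 1 2 (fixed_points F_map) = {P_min}
    \<and> with_zeros 2 3 (fixed_points F_map) = {pt_B}
    \<and> with_zeros 3 4 (fixed_points F_map) = {pt_D}
    \<and> with_zeros 4 5 (fixed_points F_map) = {Q_min}
    \<and> with_zeros 5 6 (fixed_points F_map) = {Q_max}
    \<and> with_zeros 6 7 (fixed_points F_map) = {pt_C}
    \<and> with_zeros 7 8 (fixed_points F_map) = {pt_A}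
    \<and> with_zeros 8 1 (fixed_points F_map) = {P_max}
    \<and> F_map ` fixed_points F_map = {v. v extreme_point_of octagon}
    \<and> F_map P_min = (0, 1)
    \<and> F_map pt_B = (1, 0)
    \<and> F_map pt_D = (2, 0)
    \<and> F_map Q_min = (3, 1)
    \<and> F_map Q_max = (3, 2)
    \<and> F_map pt_C = (2, 3)
    \<and> F_map pt_A = (1, 3)
    \<and> F_map P_max = (0, 2)"
proof -
  have images: "F_map P_min = (0, 1)" "F_map pt_B = (1, 0)" "F_map pt_D = (2, 0)" "F_map Q_min = (3, 1)"
    "F_map Q_max = (3, 2)" "F_map pt_C = (2, 3)" "F_map pt_A = (1, 3)" "F_map P_max = (0, 2)"
    by (rule vertices[THEN is_vertexD(2)])+
  \<comment> \<open>The eight points are distinct because their images are.\<close>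
  have "distinct (map F_map [P_min, pt_B, pt_D, Q_min, Q_max, pt_C, pt_A, P_max])"
    by (simp add: images)
  then have "distinct [P_min, pt_B, pt_D, Q_min, Q_max, pt_C, pt_A, P_max]"
    by (simp only: distinct_map)
  moreover have "F_map ` fixed_points F_map = {v. v extreme_point_of octagon}"
    unfolding fixed_points_eq extreme_points_octagon by (simp add: images)
  ultimately show ?thesis
    using fixed_points_eq images vertices[THEN with_zeros_eq] by (intro conjI)
qed

end
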